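(* Let $n\ge 5$ be odd and let $J_n$ be the flower snark. Then the mixed metric dimension satisfies $\beta_M(J_5)=5$ and $\beta_M(J_n)=4$ for all odd $n\ge 7$.
   Context: The flower snark $J_n$ has vertex set $\{a_i,b_i,c_i,d_i : 0\le i\le n-1\}$ and edge set $\{a_ib_i, a_ic_i, a_id_i, b_ib_{i+1}, c_ic_{i+1}, d_id_{i+1} : 0\le i\le n-1\}$ (indices modulo $n$), except that the edges $c_{n-1}c_0$ and $d_{n-1}d_0$ are replaced by $c_{n-1}d_0$ and $d_{n-1}c_0$. For a connected graph $G=(V,E)$, $d(u,v)$ is the shortest-path distance between vertices, and for an edge $uv$ and vertex $w$, $d(uv,w)=\min\{d(u,w),d(v,w)\}$. A set $S\subseteq V$ is a mixed resolving set if for any two distinct elements $x,y\in V\cup E$ there is $w\in S$ with $d(x,w)\neq d(y,w)$. The mixed metric dimension $\beta_M(G)$ is the minimum cardinality of a mixed resolving set of $G$. *)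

theory Defs
  imports Main
begin

(* A graph is a pair (V, E) whose edges are two-element subsets of V. *)
type_synonym 'v ugraph = "'v set \<times> 'v set set"

abbreviation verts :: "'v ugraph \<Rightarrow> 'v set" where "verts \<equiv> fst"
abbreviation edges :: "'v ugraph \<Rightarrow> 'v set set" where "edges \<equiv> snd"

definition finite_simple_graph :: "'v ugraph \<Rightarrow> bool" where
  "finite_simple_graph G \<longleftrightarrow>
     finite (verts G) \<and> (\<forall>e\<in>edges G. \<exists>u\<in>verts G. \<exists>v\<in>verts G. u \<noteq> v \<and> e = {u, v})"

definition walk :: "'v ugraph \<Rightarrow> 'v \<Rightarrow> 'v list \<Rightarrow> 'v \<Rightarrow> bool" where
  "walk G u p v \<longleftrightarrow>
     p \<noteq> [] \<and> hd p = u \<and> last p = v \<and> set p \<subseteq> verts G \<and>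
     successively (\<lambda>x y. {x, y} \<in> edges G) p"

definition connected_graph :: "'v ugraph \<Rightarrow> bool" where
  "connected_graph G \<longleftrightarrow>
     verts G \<noteq> {} \<and> (\<forall>u\<in>verts G. \<forall>v\<in>verts G. \<exists>p. walk G u p v)"

(* Only meaningful when u and v are joined by a walk; a walk on the vertex list p
   has length p - 1 edges. *)
definition gdist :: "'v ugraph \<Rightarrow> 'v \<Rightarrow> 'v \<Rightarrow> nat" where
  "gdist G u v = (LEAST k. \<exists>p. walk G u p v \<and> length p = Suc k)"

(* The set of vertices and edges, as a disjoint union: Inl v is a vertex, Inr e an edge. *)
definition elements :: "'v ugraph \<Rightarrow> ('v + 'v set) set" where
  "elements G = verts G <+> edges G"

fun elem_dist :: "'v ugraph \<Rightarrow> 'v + 'v set \<Rightarrow> 'v \<Rightarrow> nat" where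
  "elem_dist G (Inl v) w = gdist G v w"
| "elem_dist G (Inr e) w = Min ((\<lambda>u. gdist G u w) ` e)"

definition mixed_resolving_set :: "'v ugraph \<Rightarrow> 'v set \<Rightarrow> bool" where
  "mixed_resolving_set G S \<longleftrightarrow>
     S \<subseteq> verts G \<and>
     (\<forall>x\<in>elements G. \<forall>y\<in>elements G. x \<noteq> y \<longrightarrow> (\<exists>w\<in>S. elem_dist G x w \<noteq> elem_dist G y w))"

(* For finite connected simple graphs the minimum is attained; see
   mixed_metric_dimension_attained below. *)
definition mixed_metric_dimension :: "'v ugraph \<Rightarrow> nat" where
  "mixed_metric_dimension G = (LEAST k. \<exists>S. finite S \<and> mixed_resolving_set G S \<and> card S = k)"

datatype snark_vertex = A nat | B nat | C nat | D nat

(* The b-vertices form an n-cycle; the c- and d-vertices together form a 2n-cycle,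
   because of the two crossed edges in the last line. *)
definition flower_snark :: "nat \<Rightarrow> snark_vertex ugraph" where
  "flower_snark n =
    (A ` {..<n} \<union> B ` {..<n} \<union> C ` {..<n} \<union> D ` {..<n},
     {{A i, B i} | i. i < n} \<union> {{A i, C i} | i. i < n} \<union> {{A i, D i} | i. i < n} \<union>
     {{B i, B (Suc i mod n)} | i. i < n} \<union>
     {{C i, C (Suc i)} | i. Suc i < n} \<union> {{D i, D (Suc i)} | i. Suc i < n} \<union>
     {{C (n - 1), D 0}, {D (n - 1), C 0}})"

lemma finite_simple_flower_snark:
  assumes "n \<ge> 2"
  shows "finite_simple_graph (flower_snark n)"
proof -
  have ne: "i \<noteq> Suc i mod n" if "i < n" for i
    using that assms by (cases "Suc i = n") auto
  have lt: "Suc i mod n < n" for i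
    using assms by simp
  define V where "V = verts (flower_snark n)"
  have V: "A i \<in> V \<longleftrightarrow> i < n" "B i \<in> V \<longleftrightarrow> i < n" "C i \<in> V \<longleftrightarrow> i < n" "D i \<in> V \<longleftrightarrow> i < n" for i
    by (auto simp: V_def flower_snark_def)
  define P where "P e \<longleftrightarrow> (\<exists>u\<in>V. \<exists>v\<in>V. u \<noteq> v \<and> e = {u, v})" for e
  have P: "P {u, v}" if "u \<in> V" "v \<in> V" "u \<noteq> v" for u v
    using that by (auto simp: P_def)
  have "P e" if "e \<in> edges (flower_snark n)" for e
    using that assms ne lt unfolding flower_snark_def snd_conv
    by (elim UnE CollectE exE conjE insertE emptyE) (simp_all add: P V)
  then show ?thesis
    by (simp add: finite_simple_graph_def P_def V_def) (simp add: flower_snark_def)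
qed

lemma walk_trans:
  assumes "walk G u p v" "walk G v q w"
  shows "\<exists>r. walk G u r w"
proof (cases "tl q")
  case Nil
  then have "w = v" using assms(2) by (cases q) (auto simp: walk_def)
  then show ?thesis using assms(1) by blast
next
  case (Cons x xs)
  then have q: "q = v # x # xs" using assms(2) by (cases q) (auto simp: walk_def)
  have "walk G u (p @ x # xs) w"
    using assms unfolding q walk_def by (auto simp: successively_append_iff)
  then show ?thesis by blast
qed

lemma walk_rev: "walk G u p v \<Longrightarrow> walk G v (rev p) u"
  by (simp add: walk_def hd_rev last_rev insert_commute)

lemma connected_flower_snark:
  assumes "n \<ge> 1"
  shows "connected_graph (flower_snark n)"
proof -
  define V where "V = verts (flower_snark n)"
  define E where "E = edges (flower_snark n)"
  define R where "R u v \<longleftrightarrow> (\<exists>p. walk (flower_snark n) u p v)" for u v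
  have V: "V = A ` {..<n} \<union> B ` {..<n} \<union> C ` {..<n} \<union> D ` {..<n}"
    by (simp add: V_def flower_snark_def)
  have E: "{A i, B i} \<in> E" "{A i, C i} \<in> E" "{A i, D i} \<in> E" "{B i, B (Suc i mod n)} \<in> E"
    if "i < n" for i
    using that by (auto simp: E_def flower_snark_def doubleton_eq_iff)
  have trans: "R u v \<Longrightarrow> R v w \<Longrightarrow> R u w" for u v w
    unfolding R_def using walk_trans by metis
  have sym: "R u v \<Longrightarrow> R v u" for u v
    unfolding R_def using walk_rev by metis
  have edge: "R u v" if "{u, v} \<in> E" "u \<in> V" "v \<in> V" for u v
    unfolding R_def using that by (intro exI[of _ "[u, v]"]) (simp add: walk_def V_def E_def)
  have RB: "R (B 0) (B i)" if "i < n" for i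
    using that
  proof (induction i)
    case 0
    then show ?case
      unfolding R_def by (intro exI[of _ "[B 0]"]) (simp add: walk_def V_def[symmetric] V)
  next
    case (Suc i)
    have "R (B i) (B (Suc i))"
      using E(4)[of i] Suc.prems by (intro edge) (simp_all add: V)
    then show ?case using Suc trans by simp
  qed
  have RA: "R (B 0) (A i)" if "i < n" for i
    using trans[OF RB sym[OF edge[OF E(1)]]] that by (simp add: V)
  have "R (B 0) (C i)" "R (B 0) (D i)" if "i < n" for i
    using trans[OF RA edge[OF E(2)]] trans[OF RA edge[OF E(3)]] that by (simp_all add: V)
  then have "R (B 0) v" if "v \<in> V" for v
    using that RA RB by (auto simp: V)
  then have "R u v" if "u \<in> V" "v \<in> V" for u v
    using that sym trans by blast
  moreover have "V \<noteq> {}"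
    using assms by (simp add: V lessThan_empty_iff bot_nat_def)
  ultimately show ?thesis
    by (simp add: connected_graph_def V_def R_def)
qed

lemma gdist_eq_0_iff:
  assumes "connected_graph G" "u \<in> verts G" "v \<in> verts G"
  shows "gdist G u v = 0 \<longleftrightarrow> u = v"
proof
  obtain p where p: "walk G u p v" using assms by (auto simp: connected_graph_def)
  then have "\<exists>k. \<exists>p. walk G u p v \<and> length p = Suc k"
    by (intro exI[of _ "length p - 1"] exI[of _ p]) (auto simp: walk_def)
  then have "\<exists>p. walk G u p v \<and> length p = Suc (gdist G u v)"
    unfolding gdist_def by (rule LeastI_ex)
  then show "u = v" if "gdist G u v = 0"
    using that by (auto simp: walk_def length_Suc_conv)
next
  show "gdist G u v = 0" if "u = v"
    using that assms unfolding gdist_def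
    by (intro Least_eq_0 exI[of _ "[v]"]) (auto simp: walk_def)
qed

lemma mixed_resolving_set_verts:
  assumes G: "finite_simple_graph G" "connected_graph G"
  shows "mixed_resolving_set G (verts G)"
proof -
  have min_eq_0: "min k l = 0 \<longleftrightarrow> k = 0 \<or> l = 0" for k l :: nat
    by (auto simp: min_def)
  have *: "elem_dist G x w = 0 \<longleftrightarrow> (case x of Inl v \<Rightarrow> w = v | Inr e \<Rightarrow> w \<in> e)"
    if x: "x \<in> elements G" and w: "w \<in> verts G" for x w
  proof (cases x)
    case (Inl v)
    then show ?thesis using x w gdist_eq_0_iff[OF G(2)] by (auto simp: elements_def)
  next
    case (Inr e)
    then obtain a b where "a \<in> verts G" "b \<in> verts G" "e = {a, b}"
      using x G(1) by (auto simp: elements_def finite_simple_graph_def)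
    then show ?thesis using Inr w by (simp add: min_eq_0 gdist_eq_0_iff[OF G(2)]) auto
  qed
  have "\<exists>w\<in>verts G. elem_dist G x w \<noteq> elem_dist G y w"
    if x: "x \<in> elements G" and y: "y \<in> elements G" and "x \<noteq> y" for x y
  proof (rule ccontr)
    assume "\<not> ?thesis"
    then have eq: "(case x of Inl v \<Rightarrow> w = v | Inr e \<Rightarrow> w \<in> e) \<longleftrightarrow>
        (case y of Inl v \<Rightarrow> w = v | Inr e \<Rightarrow> w \<in> e)" if "w \<in> verts G" for w
      using *[OF x that] *[OF y that] that by auto
    have e: "e \<subseteq> verts G \<and> (\<exists>a b. a \<noteq> b \<and> e = {a, b})" if "Inr e \<in> elements G" for e
      using that G(1) by (fastforce simp: elements_def finite_simple_graph_def)
    show False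
    proof (cases x)
      case X: (Inl u)
      then have u: "u \<in> verts G" using x by (auto simp: elements_def)
      show False
      proof (cases y)
        case (Inl v)
        then show False using X \<open>x \<noteq> y\<close> eq[OF u] by simp
      next
        case (Inr f)
        then have "f \<subseteq> {u}" using e[of f] y X eq by auto
        then show False using e[of f] y Inr by auto
      qed
    next
      case X: (Inr f)
      show False
      proof (cases y)
        case (Inl v)
        then have "f \<subseteq> {v}" using e[of f] x X eq by auto
        then show False using e[of f] x X by auto
      next
        case (Inr g)
        then have "f = g" using e[of f] e[of g] x y X eq by auto
        then show False using X Inr \<open>x \<noteq> y\<close> by simp
      qed
    qed
  qed
  then show ?thesis by (auto simp: mixed_resolving_set_def)
qed

lemma mixed_metric_dimension_attained:
  assumes "finite_simple_graph G" "connected_graph G"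
  shows "\<exists>S. finite S \<and> mixed_resolving_set G S \<and> card S = mixed_metric_dimension G"
  unfolding mixed_metric_dimension_def
proof (rule LeastI_ex)
  have "finite (verts G)" using assms(1) by (simp add: finite_simple_graph_def)
  then show "\<exists>k S. finite S \<and> mixed_resolving_set G S \<and> card S = k"
    using mixed_resolving_set_verts[OF assms] by blast
qed

end

theory Submission
  imports Defs
begin

text \<open>
  A landmark separates a vertex \<open>v\<close> from an incident edge \<open>vx\<close> only if it is closer to \<open>x\<close> than to
  \<open>v\<close>. With three landmarks this local condition already fails somewhere for odd \<open>n \<ge> 5\<close>: if some
  \<open>a\<^sub>j\<close> is a landmark, the three edges at \<open>a\<^sub>j\<close> force a second one among the \<open>a\<close>-vertices, and the
  third landmark cannot serve all remaining \<open>a\<close>-edges; otherwise the edges at the \<open>a\<^sub>i\<close> force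
  \<open>{b\<^sub>m, c\<^sub>p, d\<^sub>p}\<close>, and then \<open>b\<^sub>m\<close> alone would have to lie on both sides of \<open>b\<^sub>p\<close>. Conversely, for
  \<open>n = 2k + 1 \<ge> 7\<close> the set \<open>{b\<^sub>0, c\<^sub>1, d\<^sub>3, c\<^bsub>k+2\<^esub>}\<close> is resolving. For \<open>n = 5\<close>, four landmarks
  would form a transversal of the separating sets of 80 chosen pairs, and a search shows that there
  is none.
\<close>

section \<open>Distances in the flower snark\<close>

text \<open>A potential certifies distances: since \<open>f\<close> changes by at most 1 along an
  edge, no walk to \<open>w\<close> is shorter than \<open>f v\<close>, and repeated descent builds
  a walk of exactly that length.\<close>

lemma gdist_eqI:
  fixes f :: "'v \<Rightarrow> nat"
  assumes lip: "\<And>u v. {u, v} \<in> edges G \<Longrightarrow> f u \<le> Suc (f v)"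
    and desc: "\<And>v. v \<in> verts G \<Longrightarrow> v \<noteq> w \<Longrightarrow>
      \<exists>u\<in>verts G. {v, u} \<in> edges G \<and> f v = Suc (f u)"
    and "f w = 0" "v \<in> verts G"
  shows "gdist G v w = f v"
  unfolding gdist_def
proof (rule Least_equality)
  show "\<exists>p. walk G v p w \<and> length p = Suc (f v)"
    using \<open>v \<in> verts G\<close>
  proof (induction "f v" arbitrary: v)
    case 0
    then have "v = w" using desc by fastforce
    then show ?case using 0 by (intro exI[of _ "[v]"]) (simp add: walk_def)
  next
    case (Suc k)
    then have "v \<noteq> w" using \<open>f w = 0\<close> by auto
    then obtain u where u: "u \<in> verts G" "{v, u} \<in> edges G" "f v = Suc (f u)"
      using desc Suc.prems by blast
    then obtain p where "walk G u p w" "length p = Suc (f u)"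
      using Suc by auto
    then show ?case using u Suc.prems
      by (intro exI[of _ "v # p"]) (auto simp: walk_def successively_Cons)
  qed
next
  fix k assume "\<exists>p. walk G v p w \<and> length p = Suc k"
  then obtain p where p: "walk G v p w" "length p = Suc k" by blast
  have "f (hd q) \<le> f (last q) + (length q - 1)"
    if "q \<noteq> []" "successively (\<lambda>x y. {x, y} \<in> edges G) q" for q
    using that
  proof (induction q rule: induct_list012)
    case (3 x y q)
    then show ?case using lip[of x y] by auto
  qed auto
  from this[of p] show "f v \<le> k" using p \<open>f w = 0\<close> by (simp add: walk_def)
qed

text \<open>
  On the \<open>2n\<close>-cycle of the \<open>c\<close>- and \<open>d\<close>-vertices, \<open>gap\<close> is the distance of equal letters and
  \<open>n - gap\<close> that of different ones; passing through \<open>a\<close>-vertices instead, one can switch letters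
  freely but pays 2 in addition to the distance \<open>cyc\<close> of the indices modulo \<open>n\<close>.
\<close>

definition gap :: "nat \<Rightarrow> nat \<Rightarrow> nat" where
  "gap i j = (i - j) + (j - i)"

definition cyc :: "nat \<Rightarrow> nat \<Rightarrow> nat \<Rightarrow> nat" where
  "cyc n i j = min (gap i j) (n - gap i j)"

definition same :: "nat \<Rightarrow> nat \<Rightarrow> nat \<Rightarrow> nat" where
  "same n i j = min (gap i j) (n + 2 - gap i j)"

definition cross :: "nat \<Rightarrow> nat \<Rightarrow> nat \<Rightarrow> nat" where
  "cross n i j = min (n - gap i j) (gap i j + 2)"

text \<open>An \<open>A\<close>-vertex has neighbours of all three letters, so only
  \<open>cyc\<close> matters when it is an endpoint; between the \<open>B\<close>-cycle and the
  other rims a walk must use two spokes. In \<open>same\<close>, \<open>n + 2 - gap\<close> is the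
  complementary arc followed by a switch of letter; in \<open>cross\<close>, \<open>gap + 2\<close>
  is the direct arc with a switch.\<close>

fun snark_dist :: "nat \<Rightarrow> snark_vertex \<Rightarrow> snark_vertex \<Rightarrow> nat" where
  "snark_dist n (A i) (A j) = (if i = j then 0 else cyc n i j + 2)"
| "snark_dist n (A i) (B j) = cyc n i j + 1"
| "snark_dist n (A i) (C j) = cyc n i j + 1"
| "snark_dist n (A i) (D j) = cyc n i j + 1"
| "snark_dist n (B i) (A j) = cyc n i j + 1"
| "snark_dist n (B i) (B j) = cyc n i j"
| "snark_dist n (B i) (C j) = cyc n i j + 2"
| "snark_dist n (B i) (D j) = cyc n i j + 2"
| "snark_dist n (C i) (A j) = cyc n i j + 1"
| "snark_dist n (C i) (B j) = cyc n i j + 2"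
| "snark_dist n (C i) (C j) = same n i j"
| "snark_dist n (C i) (D j) = cross n i j"
| "snark_dist n (D i) (A j) = cyc n i j + 1"
| "snark_dist n (D i) (B j) = cyc n i j + 2"
| "snark_dist n (D i) (C j) = cross n i j"
| "snark_dist n (D i) (D j) = same n i j"

lemma verts_snark [simp]:
  "A i \<in> verts (flower_snark n) \<longleftrightarrow> i < n" "B i \<in> verts (flower_snark n) \<longleftrightarrow> i < n"
  "C i \<in> verts (flower_snark n) \<longleftrightarrow> i < n" "D i \<in> verts (flower_snark n) \<longleftrightarrow> i < n"
  by (auto simp: flower_snark_def)

text \<open>Splitting off the closing edge of the \<open>B\<close>-cycle removes the modulus and
  gives all three rims the same shape.\<close>

lemma edges_snark:
  assumes "n > 0"
  shows "edges (flower_snark n) =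
     {{A i, B i} | i. i < n} \<union> {{A i, C i} | i. i < n} \<union> {{A i, D i} | i. i < n} \<union>
     {{B i, B (Suc i)} | i. Suc i < n} \<union> {{C i, C (Suc i)} | i. Suc i < n} \<union>
     {{D i, D (Suc i)} | i. Suc i < n} \<union>
     {{B (n - 1), B 0}, {C (n - 1), D 0}, {D (n - 1), C 0}}"
proof -
  have "{{B i, B (Suc i mod n)} | i. i < n} =
      {{B i, B (Suc i)} | i. Suc i < n} \<union> {{B (n - 1), B 0}}" (is "?L = ?R")
  proof (intro equalityI subsetI)
    fix e assume "e \<in> ?L"
    then obtain i where i: "i < n" "e = {B i, B (Suc i mod n)}" by blast
    show "e \<in> ?R"
    proof (cases "Suc i = n")
      case True
      then have "i = n - 1" by simp
      then show ?thesis using i True by simp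
    next
      case False
      then show ?thesis using i by auto
    qed
  next
    fix e assume "e \<in> ?R"
    then show "e \<in> ?L"
    proof
      assume "e \<in> {{B (n - 1), B 0}}"
      then show ?thesis using assms by (intro CollectI exI[of _ "n - 1"]) simp
    qed force
  qed
  then show ?thesis
    unfolding flower_snark_def snd_conv
    by (simp only: Un_insert_left Un_insert_right Un_empty_left Un_empty_right Un_assoc
        Un_left_commute insert_commute)
qed

lemma edge_snark:
  "i < n \<Longrightarrow> {A i, B i} \<in> edges (flower_snark n)"
  "i < n \<Longrightarrow> {A i, C i} \<in> edges (flower_snark n)"
  "i < n \<Longrightarrow> {A i, D i} \<in> edges (flower_snark n)"
  "Suc i < n \<Longrightarrow> {B i, B (Suc i)} \<in> edges (flower_snark n)"
  "Suc i < n \<Longrightarrow> {C i, C (Suc i)} \<in> edges (flower_snark n)"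
  "Suc i < n \<Longrightarrow> {D i, D (Suc i)} \<in> edges (flower_snark n)"
  "n > 0 \<Longrightarrow> {B (n - 1), B 0} \<in> edges (flower_snark n)"
  "n > 0 \<Longrightarrow> {C (n - 1), D 0} \<in> edges (flower_snark n)"
  "n > 0 \<Longrightarrow> {D (n - 1), C 0} \<in> edges (flower_snark n)"
  by (auto simp: edges_snark doubleton_eq_iff)

section \<open>Lipschitz bounds along the edges\<close>

lemma gap_less: "i < n \<Longrightarrow> j < n \<Longrightarrow> gap i j < n"
  by (auto simp: gap_def)

lemma gap_Suc: "gap (Suc i) j = (if j \<le> i then Suc (gap i j) else gap i j - 1)"
  by (auto simp: gap_def)

lemma gap_0: "gap 0 j = j"
  by (simp add: gap_def)

lemma gap_last: "Suc i = n \<Longrightarrow> j < n \<Longrightarrow> gap i j = i - j"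
  by (simp add: gap_def)

lemma cyc_self [simp]: "cyc n i i = 0"
  by (simp add: cyc_def gap_def)

lemma rim_lipschitz:
  assumes "Suc i < n" "j < n"
  shows "cyc n i j \<le> Suc (cyc n (Suc i) j)" "cyc n (Suc i) j \<le> Suc (cyc n i j)"
    "same n i j \<le> Suc (same n (Suc i) j)" "same n (Suc i) j \<le> Suc (same n i j)"
    "cross n i j \<le> Suc (cross n (Suc i) j)" "cross n (Suc i) j \<le> Suc (cross n i j)"
  unfolding cyc_def same_def cross_def gap_Suc using gap_less[of i n j] assms
  by (auto simp: min_def)

text \<open>The closing edges exchange \<open>C\<close> and \<open>D\<close>, hence
  \<open>same\<close> is compared with \<open>cross\<close> here.\<close>

lemma wrap_lipschitz:
  assumes "n > 0" "j < n"
  shows "cyc n (n - Suc 0) j \<le> Suc (cyc n 0 j)" "cyc n 0 j \<le> Suc (cyc n (n - Suc 0) j)"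
    "same n (n - Suc 0) j \<le> Suc (cross n 0 j)" "cross n 0 j \<le> Suc (same n (n - Suc 0) j)"
    "cross n (n - Suc 0) j \<le> Suc (same n 0 j)" "same n 0 j \<le> Suc (cross n (n - Suc 0) j)"
  using assms by (auto simp: cyc_def same_def cross_def gap_0 gap_last)

text \<open>Since \<open>A i\<close> has distance \<open>cyc + 1\<close> to \<open>C j\<close> and
  \<open>D j\<close>, the spokes at \<open>A i\<close> require exactly that \<open>same\<close> and
  \<open>cross\<close> lie between \<open>cyc\<close> and \<open>cyc + 2\<close>.\<close>

lemma spoke_lipschitz:
  assumes "i < n" "j < n"
  shows "cyc n i j \<le> same n i j" "same n i j \<le> Suc (Suc (cyc n i j))"
    "cyc n i j \<le> cross n i j" "cross n i j \<le> Suc (Suc (cyc n i j))"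
  using gap_less[OF assms] by (auto simp: cyc_def same_def cross_def)

lemma snark_dist_lipschitz:
  assumes "w \<in> verts (flower_snark n)" "{u, v} \<in> edges (flower_snark n)"
  shows "snark_dist n u w \<le> Suc (snark_dist n v w)"
proof -
  have "n > 0" using assms by (cases w) auto
  show ?thesis
    using \<open>n > 0\<close> assms(1,2) unfolding edges_snark[OF \<open>n > 0\<close>]
    by (cases w) (auto simp: doubleton_eq_iff rim_lipschitz wrap_lipschitz spoke_lipschitz
       le_SucI)
qed

section \<open>Descent to a neighbour closer to the target\<close>

lemma rim_descent_up:
  assumes "i < j" "j < n"
  shows "j - i \<le> n - (j - i) \<Longrightarrow> cyc n i j = Suc (cyc n (Suc i) j)"
    "j - i \<le> n + 2 - (j - i) \<Longrightarrow> same n i j = Suc (same n (Suc i) j)"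
    "n + 2 - (j - i) \<le> j - i \<Longrightarrow> same n i j = Suc (Suc (cyc n i j))"
  using assms by (auto simp: cyc_def same_def gap_def)

lemma rim_descent_down:
  assumes "i \<le> j" "Suc j < n"
  shows "Suc j - i \<le> n - (Suc j - i) \<Longrightarrow> cyc n (Suc j) i = Suc (cyc n j i)"
    "Suc j - i \<le> n + 2 - (Suc j - i) \<Longrightarrow> same n (Suc j) i = Suc (same n j i)"
    "n + 2 - (Suc j - i) \<le> Suc j - i \<Longrightarrow> same n (Suc j) i = Suc (Suc (cyc n (Suc j) i))"
  using assms by (auto simp: cyc_def same_def gap_def)

lemma rim_descent_away:
  assumes "j \<le> i" "Suc i < n"
  shows "n - (i - j) \<le> i - j \<Longrightarrow> cyc n i j = Suc (cyc n (Suc i) j)"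
    "n - (i - j) \<le> i - j + 2 \<Longrightarrow> cross n i j = Suc (cross n (Suc i) j)"
  using assms by (auto simp: cyc_def same_def cross_def gap_def)

lemma rim_descent_back:
  assumes "Suc i \<le> j" "j < n"
  shows "n - (j - Suc i) \<le> j - Suc i \<Longrightarrow> cyc n (Suc i) j = Suc (cyc n i j)"
    "n - (j - Suc i) \<le> j - Suc i + 2 \<Longrightarrow> cross n (Suc i) j = Suc (cross n i j)"
  using assms by (auto simp: cyc_def same_def cross_def gap_def)

lemma wrap_descent:
  assumes "j < n"
  shows "n - j \<le> j \<Longrightarrow> cyc n 0 j = Suc (cyc n (n - Suc 0) j)"
    "n - j \<le> j + 2 \<Longrightarrow> cross n 0 j = Suc (same n (n - Suc 0) j)"
    "Suc j \<le> n - Suc j \<Longrightarrow> cyc n (n - Suc 0) j = Suc (cyc n 0 j)"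
    "Suc j \<le> n - Suc j + 2 \<Longrightarrow> cross n (n - Suc 0) j = Suc (same n 0 j)"
  using assms by (auto simp: cyc_def same_def cross_def gap_def)

lemma cyc_descent:
  assumes "i < n" "j < n" "i \<noteq> j"
  shows "(Suc i < n \<and> cyc n i j = Suc (cyc n (Suc i) j)) \<or>
    (\<exists>u. i = Suc u \<and> cyc n i j = Suc (cyc n u j)) \<or>
    (i = n - Suc 0 \<and> cyc n i j = Suc (cyc n 0 j)) \<or>
    (i = 0 \<and> cyc n i j = Suc (cyc n (n - Suc 0) j))"
proof -
  consider "i < j" "j - i \<le> n - (j - i)" | "i < j" "n - (j - i) \<le> j - i" "i = 0"
    | u where "i = Suc u" "Suc u < j" "n - (j - i) \<le> j - i"
    | u where "i = Suc u" "j \<le> u" "i - j \<le> n - (i - j)"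
    | "j < i" "n - (i - j) \<le> i - j" "Suc i < n" | "j < i" "n - (i - j) \<le> i - j" "i = n - Suc 0"
    using assms by (cases i) fastforce+
  then show ?thesis
  proof cases
    case 1 then show ?thesis using rim_descent_up(1) assms by simp
  next
    case 2 then show ?thesis using wrap_descent(1) assms by simp
  next
    case 3 then show ?thesis using rim_descent_back(1) assms by simp
  next
    case 4 then show ?thesis using rim_descent_down(1) assms by simp
  next
    case 5 then show ?thesis using rim_descent_away(1) assms by simp
  next
    case 6 then show ?thesis using wrap_descent(3) assms by simp
  qed
qed

text \<open>If the complementary arc attains the minimum, then \<open>same\<close> is
  \<open>cyc + 2\<close> and the spoke to \<open>A i\<close> descends; otherwise the direct arc
  does, and it never uses a closing edge.\<close>

lemma same_descent:
  assumes "i < n" "j < n" "i \<noteq> j"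
  shows "same n i j = Suc (Suc (cyc n i j)) \<or>
    (Suc i < n \<and> same n i j = Suc (same n (Suc i) j)) \<or>
    (\<exists>u. i = Suc u \<and> same n i j = Suc (same n u j))"
proof -
  consider "i < j" | u where "i = Suc u" "j \<le> u"
    using assms by (cases i) fastforce+
  then show ?thesis
  proof cases
    case 1 then show ?thesis using rim_descent_up(2,3)[of i j n] assms by linarith
  next
    case 2 then show ?thesis using rim_descent_down(2,3)[of j u n] assms by force
  qed
qed

text \<open>Here the direct arc is the one that needs a switch of letter, so the spoke descends when
  it attains the minimum. Otherwise the walk follows the complementary arc, whose closing edge turns
  \<open>cross\<close> into \<open>same\<close>.\<close>

lemma cross_descent:
  assumes "i < n" "j < n"
  shows "cross n i j = Suc (Suc (cyc n i j)) \<or>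
    (Suc i < n \<and> cross n i j = Suc (cross n (Suc i) j)) \<or>
    (\<exists>u. i = Suc u \<and> cross n i j = Suc (cross n u j)) \<or>
    (i = n - Suc 0 \<and> cross n i j = Suc (same n 0 j)) \<or>
    (i = 0 \<and> cross n i j = Suc (same n (n - Suc 0) j))"
proof (cases "gap i j + 2 \<le> n - gap i j")
  case True then show ?thesis by (simp add: cross_def cyc_def)
next
  case False
  consider "i \<le> j" "n - (j - i) \<le> j - i + 2" "i = 0"
    | u where "i = Suc u" "Suc u \<le> j" "n - (j - i) \<le> j - i + 2"
    | "j \<le> i" "n - (i - j) \<le> i - j + 2" "Suc i < n" | "j \<le> i" "n - (i - j) \<le> i - j + 2" "i = n - Suc 0"
    using assms False by (cases i; cases "i \<le> j") (fastforce simp: gap_def)+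
  then show ?thesis
  proof cases
    case 1 then show ?thesis using wrap_descent(2) assms by simp
  next
    case 2 then show ?thesis using rim_descent_back(2) assms by simp
  next
    case 3 then show ?thesis using rim_descent_away(2) assms by simp
  next
    case 4 then show ?thesis using wrap_descent(4)[of j n] assms by simp
  qed
qed

text \<open>Provides the descent from \<open>A i\<close> to \<open>C j\<close> or
  \<open>D j\<close>: one of \<open>C i\<close>, \<open>D i\<close> carries the letter that the
  shorter arc leads to the target.\<close>

lemma same_or_cross:
  assumes "i < n" "j < n"
  shows "same n i j = cyc n i j \<or> cross n i j = cyc n i j"
  using gap_less[OF assms] by (auto simp: cyc_def same_def cross_def)

lemma same_self [simp]: "same n i i = 0"
  by (simp add: same_def gap_def)

lemma edge_snark_sym:
  "{v, u} \<in> edges (flower_snark n) \<Longrightarrow> {u, v} \<in> edges (flower_snark n)"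
  by (simp add: insert_commute)

lemmas edge_snark' = edge_snark[simplified] edge_snark[THEN edge_snark_sym, simplified]

lemma snark_dist_descent:
  assumes "v \<in> verts (flower_snark n)" "w \<in> verts (flower_snark n)" "v \<noteq> w"
  shows "\<exists>u\<in>verts (flower_snark n). {v, u} \<in> edges (flower_snark n) \<and>
    snark_dist n v w = Suc (snark_dist n u w)"
proof -
  have "n > 0" using assms by (cases w) auto
  note [simp] = edge_snark' this
  \<comment> \<open>For a target \<open>A j\<close> the letter reached across a closing edge is
    immaterial, so \<open>u\<close> is left unspecified and only its index counts.\<close>
  have cyc: "\<exists>u\<in>verts (flower_snark n). {B i, u} \<in> edges (flower_snark n) \<and>
      snark_dist n u (B j) + 1 = cyc n i j \<and> snark_dist n u (A j) = cyc n i j"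
      "\<exists>u\<in>verts (flower_snark n). {C i, u} \<in> edges (flower_snark n) \<and> snark_dist n u (A j) = cyc n i j"
      "\<exists>u\<in>verts (flower_snark n). {D i, u} \<in> edges (flower_snark n) \<and> snark_dist n u (A j) = cyc n i j"
    if "i < n" "j < n" "i \<noteq> j" for i j
    using cyc_descent[OF that] that(1,2)
    by (elim disjE conjE exE; force intro: bexI[of _ "B k" for k] bexI[of _ "C k" for k] bexI[of _ "D k" for k])+
  show ?thesis
  proof (cases v)
    case v: (A i)
    note [intro] = bexI[of _ "B i"] bexI[of _ "C i"] bexI[of _ "D i"]
    show ?thesis
    proof (cases w)
      case (A j) then show ?thesis using assms v by auto
    next
      case (B j) then show ?thesis using assms v by auto
    next
      case (C j) then show ?thesis using assms v same_or_cross[of i n j] by auto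
    next
      case (D j) then show ?thesis using assms v same_or_cross[of i n j] by auto
    qed
  next
    case v: (B i)
    note [intro] = bexI[of _ "A i"]
    show ?thesis
    proof (cases w)
      case (A j) then show ?thesis using assms v cyc(1)[of i j] by (cases "i = j") auto
    next
      case (B j) then show ?thesis using assms v cyc(1)[of i j] by auto
    next
      case (C j) then show ?thesis using assms v by auto
    next
      case (D j) then show ?thesis using assms v by auto
    qed
  next
    case v: (C i)
    note [intro] = bexI[of _ "A i"] bexI[of _ "C (Suc i)"] bexI[of _ "C (i - 1)"]
      bexI[of _ "D (Suc i)"] bexI[of _ "D (i - 1)"] bexI[of _ "C 0"] bexI[of _ "C (n - Suc 0)"]
      bexI[of _ "D 0"] bexI[of _ "D (n - Suc 0)"]
    show ?thesis
    proof (cases w)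
      case (A j) then show ?thesis using assms v cyc(2)[of i j] by (cases "i = j") auto
    next
      case (B j) then show ?thesis using assms v by auto
    next
      case (C j) then show ?thesis using assms v same_descent[of i n j] by auto
    next
      case (D j) then show ?thesis using assms v cross_descent[of i n j] by auto
    qed
  next
    case v: (D i)
    note [intro] = bexI[of _ "A i"] bexI[of _ "C (Suc i)"] bexI[of _ "C (i - 1)"]
      bexI[of _ "D (Suc i)"] bexI[of _ "D (i - 1)"] bexI[of _ "C 0"] bexI[of _ "C (n - Suc 0)"]
      bexI[of _ "D 0"] bexI[of _ "D (n - Suc 0)"]
    show ?thesis
    proof (cases w)
      case (A j) then show ?thesis using assms v cyc(3)[of i j] by (cases "i = j") auto
    next
      case (B j) then show ?thesis using assms v by auto
    next
      case (C j) then show ?thesis using assms v cross_descent[of i n j] by auto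
    next
      case (D j) then show ?thesis using assms v same_descent[of i n j] by auto
    qed
  qed
qed

lemma snark_dist_self [simp]: "snark_dist n v v = 0"
  by (cases v) auto

lemma gdist_snark:
  assumes "v \<in> verts (flower_snark n)" "w \<in> verts (flower_snark n)"
  shows "gdist (flower_snark n) v w = snark_dist n v w"
  using assms snark_dist_lipschitz snark_dist_descent
  by (intro gdist_eqI[where f = "\<lambda>v. snark_dist n v w"]) auto

section \<open>Three landmarks do not suffice\<close>

text \<open>The distance of the edge is the minimum over its two ends, so it differs from that of
  \<open>v\<close> only if \<open>x\<close> is strictly closer.\<close>

lemma closer_landmark:
  assumes "mixed_resolving_set (flower_snark n) S" "{v, x} \<in> edges (flower_snark n)"
    "v \<in> verts (flower_snark n)" "x \<in> verts (flower_snark n)"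
  shows "\<exists>w\<in>S. snark_dist n x w < snark_dist n v w"
proof -
  have "Inl v \<in> elements (flower_snark n)" "Inr {v, x} \<in> elements (flower_snark n)"
    using assms by (auto simp: elements_def)
  then obtain w where w: "w \<in> S" "w \<in> verts (flower_snark n)"
    "elem_dist (flower_snark n) (Inl v) w \<noteq> elem_dist (flower_snark n) (Inr {v, x}) w"
    using assms(1) unfolding mixed_resolving_set_def by blast
  then show ?thesis
    using assms by (intro bexI[of _ w]) (auto simp: gdist_snark min_def split: if_splits)
qed

text \<open>Some index lies within \<open>k\<close> of both \<open>p\<close> and \<open>q\<close>.
  Two landmarks with the same letter therefore fail together on one of the edges
  \<open>A i\<close>-\<open>C i\<close>, \<open>A i\<close>-\<open>D i\<close> there.\<close>

lemma half_rims_not_complementary: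
  assumes "n = 2 * k + 1" "p < n" "q < n"
  shows "\<exists>i<n. (gap i p \<le> k) = (gap i q \<le> k)"
proof (cases "k \<le> p \<or> k \<le> q")
  case True
  then show ?thesis
    using assms by (intro exI[of _ "max p q - k"]) (auto simp: gap_def max_def)
next
  case False
  then show ?thesis using assms by (intro exI[of _ 0]) (auto simp: gap_def)
qed

text \<open>The witness has gap exactly \<open>k + 1\<close> from one of the two indices and at most
  \<open>k\<close> from the other. It forces a \<open>C\<close>- and a \<open>D\<close>-landmark
  serving all \<open>A i\<close> to have equal index.\<close>

lemma half_rims_differ:
  assumes "n = 2 * k + 1" "p < q" "q < n"
  shows "\<exists>i<n. (gap i p \<le> k) \<noteq> (gap i q \<le> k)"
proof (cases "p < k")
  case True
  then show ?thesis using assms by (intro exI[of _ "p + k + 1"]) (auto simp: gap_def)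
next
  case False
  then show ?thesis using assms by (intro exI[of _ "q - k - 1"]) (auto simp: gap_def)
qed

text \<open>On an odd cycle the two vertices farthest from \<open>m\<close> are adjacent, so the
  distance to \<open>m\<close> has no strict local maximum.\<close>

lemma cyc_no_peak:
  assumes "odd n" "p < n" "m < n"
  shows "cyc n p m \<le> cyc n (if Suc p < n then Suc p else 0) m \<or>
    cyc n p m \<le> cyc n (if p = 0 then n - 1 else p - 1) m"
proof -
  obtain k where k: "n = 2 * k + 1" using assms by (elim oddE)
  consider "p = m" | "p < m" "m - p \<le> k" | "p < m" "k < m - p" | "m < p" "p - m \<le> k" | "m < p" "k < p - m"
    by linarith
  then show ?thesis
    using assms(2,3) unfolding k by cases (auto simp: cyc_def gap_def)
qed

lemma no_resolving_triple:
  assumes n: "odd n" "n \<ge> 5"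
    and V: "{s, t, u} \<subseteq> verts (flower_snark n)"
  shows "\<not> mixed_resolving_set (flower_snark n) {s, t, u}"
proof
  assume "mixed_resolving_set (flower_snark n) {s, t, u}"
  then obtain S where S: "S = {s, t, u}" "mixed_resolving_set (flower_snark n) S" by blast
  define closer where "closer v x w \<longleftrightarrow> snark_dist n x w < snark_dist n v w" for v x w
  have ex: "\<exists>w\<in>S. closer v x w"
    if "{v, x} \<in> edges (flower_snark n)" "v \<in> verts (flower_snark n)"
      "x \<in> verts (flower_snark n)" for v x
    unfolding closer_def using closer_landmark[OF S(2) that] .
  have exA: "\<exists>w\<in>S. closer (A i) (B i) w" "\<exists>w\<in>S. closer (A i) (C i) w"
      "\<exists>w\<in>S. closer (A i) (D i) w" "\<exists>w\<in>S. closer (B i) (A i) w"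
      "\<exists>w\<in>S. closer (C i) (A i) w" "\<exists>w\<in>S. closer (D i) (A i) w" if "i < n" for i
    using that by (auto intro!: ex simp: edge_snark')
  have type: "\<exists>i<n. w = A i \<or> w = B i \<or> w = C i \<or> w = D i" if "w \<in> S" for w
    using that V S(1) by (cases w) auto
  obtain k where k: "n = 2 * k + 1" using n by (elim oddE)
  have AB: "closer (A i) (B i) w \<longleftrightarrow> (\<exists>j. w = A j \<and> j \<noteq> i) \<or> (\<exists>j. w = B j)" if "w \<in> S" "i < n" for w i
    using type[OF \<open>w \<in> S\<close>] gap_less[OF _ \<open>i < n\<close>] by (auto simp: closer_def)
  have BA: "closer (B i) (A i) w \<longleftrightarrow> w = A i \<or> (\<exists>j. w = C j) \<or> (\<exists>j. w = D j)" if "w \<in> S" "i < n" for w i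
    using type[OF \<open>w \<in> S\<close>] gap_less[OF _ \<open>i < n\<close>] by (auto simp: closer_def)
  \<comment> \<open>As \<open>n\<close> is \<open>2 * k + 1\<close>, the two arcs never tie: up to
    gap \<open>k\<close> the direct arc is shorter and keeps the letter, beyond that the
    complementary arc is shorter and changes it.\<close>
  have AC: "closer (A i) (C i) w \<longleftrightarrow> (\<exists>j. w = A j \<and> j \<noteq> i) \<or> (\<exists>j. w = C j \<and> gap i j \<le> k) \<or>
      (\<exists>j. w = D j \<and> k < gap i j)" if "w \<in> S" "i < n" for w i
    using type[OF \<open>w \<in> S\<close>] gap_less[OF \<open>i < n\<close>] k
    by (fastforce simp: closer_def cyc_def same_def cross_def)
  have AD: "closer (A i) (D i) w \<longleftrightarrow> (\<exists>j. w = A j \<and> j \<noteq> i) \<or> (\<exists>j. w = D j \<and> gap i j \<le> k) \<or>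
      (\<exists>j. w = C j \<and> k < gap i j)" if "w \<in> S" "i < n" for w i
    using type[OF \<open>w \<in> S\<close>] gap_less[OF \<open>i < n\<close>] k
    by (fastforce simp: closer_def cyc_def same_def cross_def)
  have card: False if "distinct [a, b, c, d]" "{a, b, c, d} \<subseteq> S" for a b c d
    using card_mono[OF _ that(2)] distinct_card[OF that(1)] S(1) card_length[of "[s, t, u]"] by auto
  show False
  proof (cases "\<exists>j. A j \<in> S")
    case True
    then obtain j where j: "A j \<in> S" "j < n" using type by fastforce
    \<comment> \<open>If \<open>A j\<close> were the only \<open>A\<close>-landmark, its three edges
      would need three different further landmarks.\<close>
    have "\<exists>m. m \<noteq> j \<and> A m \<in> S"
    proof (rule ccontr)
      assume no: "\<not> ?thesis"
      obtain w1 w2 w3 where w: "w1 \<in> S" "w2 \<in> S" "w3 \<in> S"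
        "closer (A j) (B j) w1" "closer (A j) (C j) w2" "closer (A j) (D j) w3"
        using exA(1-3)[OF \<open>j < n\<close>] by blast
      then have "distinct [A j, w1, w2, w3]"
        using no AB[OF w(1) j(2)] AC[OF w(2) j(2)] AD[OF w(3) j(2)] by auto
      then show False using card w j by auto
    qed
    then obtain m where m: "A m \<in> S" "m \<noteq> j" by blast
    have "\<exists>i<n. i \<noteq> j \<and> i \<noteq> m \<and> A i \<notin> S"
    proof (rule ccontr)
      assume no: "\<not> ?thesis"
      have "\<exists>a b. a < 4 \<and> b < 4 \<and> a \<noteq> b \<and> a \<noteq> j \<and> a \<noteq> m \<and> b \<noteq> j \<and> b \<noteq> m"
        by presburger
      then obtain a b where "a < 4" "b < 4" "a \<noteq> b" "a \<noteq> j" "a \<noteq> m" "b \<noteq> j" "b \<noteq> m" by blast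
      moreover have "a < n" "b < n" using \<open>a < 4\<close> \<open>b < 4\<close> n(2) by auto
      moreover have "A a \<in> S" "A b \<in> S" using calculation no by blast+
      ultimately show False using card[of "A j" "A m" "A a" "A b"] j m by auto
    qed
    then obtain i where "i < n" "A i \<notin> S" by blast
    \<comment> \<open>Apart from \<open>A i\<close> itself, only \<open>C\<close>- and
      \<open>D\<close>-landmarks are closer to \<open>A i\<close> than to
      \<open>B i\<close>.\<close>
    then obtain w where w: "w \<in> S" "\<exists>p. w = C p \<or> w = D p"
      using exA(4) BA by metis
    then obtain p where p: "p < n" "w = C p \<or> w = D p" using type[OF w(1)] by auto
    have S3: "v \<in> {A j, A m, w}" if "v \<in> S" for v
      using card[of "A j" "A m" w v] that j m w by auto
    \<comment> \<open>Three indices on the side of \<open>p\<close> with enough room leave one that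
      avoids \<open>j\<close> and \<open>m\<close>. So near to \<open>p\<close>, the direct arc is
      optimal, so \<open>w\<close> is not closer to \<open>A i\<close> than to the rim vertex of its
      own letter; neither are \<open>A j\<close> and \<open>A m\<close>.\<close>
    have "\<exists>i<n. gap i p \<le> 2 \<and> i \<noteq> j \<and> i \<noteq> m"
    proof -
      define f where "f x = (if p < 2 then p + x else p - x)" for x :: nat
      have "f x < n \<and> gap (f x) p \<le> 2" if "x \<in> {0, 1, 2}" for x
        using that p n by (auto simp: f_def gap_def)
      moreover have "f 0 \<noteq> f 1" "f 0 \<noteq> f 2" "f 1 \<noteq> f 2" by (auto simp: f_def)
      ultimately show ?thesis by (metis insertCI)
    qed
    then obtain i where i: "i < n" "gap i p \<le> 2" "i \<noteq> j" "i \<noteq> m" by blast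
    from p(2) show False
    proof
      assume "w = C p"
      moreover obtain v where "v \<in> S" "closer (C i) (A i) v" using exA(5) i by blast
      ultimately show False
        using S3[of v] i n by (auto simp: closer_def cyc_def same_def split: if_splits)
    next
      assume "w = D p"
      moreover obtain v where "v \<in> S" "closer (D i) (A i) v" using exA(6) i by blast
      ultimately show False
        using S3[of v] i n by (auto simp: closer_def cyc_def same_def split: if_splits)
    qed
  next
    case noA: False
    have "0 < n" using n by simp
    obtain w1 w2 w3 where w: "w1 \<in> S" "w2 \<in> S" "w3 \<in> S"
      "closer (A 0) (B 0) w1" "closer (A 0) (C 0) w2" "closer (A 0) (D 0) w3"
      using exA(1-3)[OF \<open>0 < n\<close>] by blast
    then obtain m where m: "w1 = B m" "m < n"
      using noA AB[OF w(1) \<open>0 < n\<close>] type[OF w(1)] by auto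
    have w23: "w2 \<noteq> w3" "\<exists>p<n. w2 = C p \<or> w2 = D p" "\<exists>p<n. w3 = C p \<or> w3 = D p"
      using w noA AC[OF w(2) \<open>0 < n\<close>] AD[OF w(3) \<open>0 < n\<close>] type[OF w(2)] type[OF w(3)] by auto
    have S3: "v = B m \<or> v = w2 \<or> v = w3" if "v \<in> S" for v
      using card[of w1 w2 w3 v] that w w23 m by auto
    have cover: "closer (A i) (C i) w2 \<or> closer (A i) (C i) w3"
        "closer (A i) (D i) w2 \<or> closer (A i) (D i) w3" if "i < n" for i
      using exA(2,3)[OF that] S3 AC[OF _ that] AD[OF _ that] m(1) by force+
    have cl: "closer (A i) (C i) w \<longleftrightarrow> (\<exists>j. w = C j \<and> gap i j \<le> k) \<or> (\<exists>j. w = D j \<and> \<not> gap i j \<le> k)"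
      "closer (A i) (D i) w \<longleftrightarrow> (\<exists>j. w = D j \<and> gap i j \<le> k) \<or> (\<exists>j. w = C j \<and> \<not> gap i j \<le> k)"
      if "w \<in> S" "i < n" for w i using AC[OF that] AD[OF that] noA that by force+
    have opp: "w2 = C p \<and> w3 = D q \<or> w2 = D p \<and> w3 = C q"
      if "w2 = C p \<or> w2 = D p" "w3 = C q \<or> w3 = D q" "p < n" "q < n" for p q
      using half_rims_not_complementary[OF k that(3,4)] cover that(1,2) cl[OF w(2)] cl[OF w(3)] by auto
    have eq: "(gap i p \<le> k) = (gap i q \<le> k)"
      if "w2 = C p \<and> w3 = D q \<or> w2 = D p \<and> w3 = C q" "i < n" for i p q
      using cover[OF that(2)] that cl[OF w(2) that(2)] cl[OF w(3) that(2)] by auto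
    obtain p q where pq: "p < n" "q < n" "w2 = C p \<and> w3 = D q \<or> w2 = D p \<and> w3 = C q"
      using w23 opp by metis
    then have "p = q"
      using eq half_rims_differ[OF k, of p q] half_rims_differ[OF k, of q p] by (metis nat_neq_iff)
    \<comment> \<open>Both other landmarks have index \<open>p\<close>, so among the
      \<open>B\<close>-vertices they are nearest to \<open>B p\<close>; only \<open>B m\<close> can
      serve the edges leaving it.\<close>
    have "cyc n u m < cyc n p m" if u: "{B p, B u} \<in> edges (flower_snark n)" "u < n" for u
    proof -
      obtain v where "v \<in> S" "closer (B p) (B u) v" using ex[OF u(1)] u(2) pq(1) by auto
      then show ?thesis using S3[of v] pq(3) \<open>p = q\<close> by (auto simp: closer_def)
    qed
    moreover have "{B p, B (if Suc p < n then Suc p else 0)} \<in> edges (flower_snark n)"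
      "{B p, B (if p = 0 then n - 1 else p - 1)} \<in> edges (flower_snark n)"
    proof -
      have "p = n - 1" if "\<not> Suc p < n" using that pq(1) by simp
      then show "{B p, B (if Suc p < n then Suc p else 0)} \<in> edges (flower_snark n)"
        using \<open>0 < n\<close> by (auto simp: edge_snark')
      show "{B p, B (if p = 0 then n - 1 else p - 1)} \<in> edges (flower_snark n)"
        using \<open>0 < n\<close> pq(1) by (cases p) (auto simp: edge_snark')
    qed
    ultimately show False
      using cyc_no_peak[OF n(1) pq(1) m(2)] pq(1) \<open>0 < n\<close> by (smt (verit) One_nat_def diff_less less_imp_diff_less not_le zero_less_one)
  qed
qed

section \<open>Enumeration of vertices and edges\<close>

text \<open>Computable form of \<open>elem_dist\<close>, with a vertex given as a singleton list and
  an edge as the list of its ends.\<close>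

fun list_dist :: "nat \<Rightarrow> snark_vertex list \<Rightarrow> snark_vertex \<Rightarrow> nat" where
  "list_dist n [] w = 0"
| "list_dist n [v] w = snark_dist n v w"
| "list_dist n (v # vs) w = min (snark_dist n v w) (list_dist n vs w)"

text \<open>Each rim edge is assigned to the index it leaves in cyclic direction. For
  \<open>n \<ge> 3\<close> every element is then listed once, in one orientation, so that
  injectivity can be stated on lists.\<close>

definition snark_star :: "nat \<Rightarrow> nat \<Rightarrow> snark_vertex list list" where
  "snark_star n i = [[A i], [B i], [C i], [D i], [A i, B i], [A i, C i], [A i, D i]] @
    (if Suc i < n then [[B i, B (Suc i)], [C i, C (Suc i)], [D i, D (Suc i)]]
     else [[B i, B 0], [C i, D 0], [D i, C 0]])"

definition elem_of :: "'v list \<Rightarrow> 'v + 'v set" where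
  "elem_of xs = (if length xs = 1 then Inl (hd xs) else Inr (set xs))"

lemma elem_of_simps [simp]: "elem_of [v] = Inl v" "elem_of [u, v] = Inr {u, v}"
  by (simp_all add: elem_of_def)

lemma elem_of_star:
  assumes "i < n" "xs \<in> set (snark_star n i)"
  shows "elem_of xs \<in> elements (flower_snark n) \<and> xs \<noteq> [] \<and> set xs \<subseteq> verts (flower_snark n)"
proof (cases "Suc i < n")
  case True
  then show ?thesis
    using assms by (auto simp: snark_star_def elements_def edge_snark)
next
  case False
  then have "i = n - 1" using assms by simp
  then show ?thesis
    using assms by (auto simp: snark_star_def elements_def edge_snark edge_snark[simplified])
qed

lemma ex_elem_of_star:
  assumes "n > 0" "x \<in> elements (flower_snark n)"
  shows "\<exists>i<n. \<exists>xs\<in>set (snark_star n i). elem_of xs = x"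
proof (cases x)
  case (Inl v)
  then obtain i where "i < n" "v \<in> {A i, B i, C i, D i}"
    using assms by (cases v) (auto simp: elements_def)
  then show ?thesis
    unfolding Inl by (intro exI[of _ i] conjI bexI[of _ "[v]"]) (auto simp: snark_star_def)
next
  case (Inr e)
  then have e: "e \<in> edges (flower_snark n)" using assms by (auto simp: elements_def)
  define T where "T = {x. \<exists>i<n. \<exists>xs\<in>set (snark_star n i). elem_of xs = x}"
  have T: "elem_of xs \<in> T" if "i < n" "xs \<in> set (snark_star n i)" for i xs
    using that by (auto simp: T_def)
  have "Inr {A i, B i} \<in> T" "Inr {A i, C i} \<in> T" "Inr {A i, D i} \<in> T" if "i < n" for i
    using T[OF that, of "[A i, B i]"] T[OF that, of "[A i, C i]"] T[OF that, of "[A i, D i]"]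
    by (simp_all add: snark_star_def)
  moreover have "Inr {B i, B (Suc i)} \<in> T" "Inr {C i, C (Suc i)} \<in> T" "Inr {D i, D (Suc i)} \<in> T"
    if "Suc i < n" for i
    using T[of i "[B i, B (Suc i)]"] T[of i "[C i, C (Suc i)]"] T[of i "[D i, D (Suc i)]"] that
    by (simp_all add: snark_star_def)
  moreover have "Inr {B (n - 1), B 0} \<in> T" "Inr {C (n - 1), D 0} \<in> T" "Inr {D (n - 1), C 0} \<in> T"
    using T[of "n - 1" "[B (n - 1), B 0]"] T[of "n - 1" "[C (n - 1), D 0]"]
      T[of "n - 1" "[D (n - 1), C 0]"] assms(1)
    by (simp_all add: snark_star_def)
  ultimately have "Inr e \<in> T"
    using e unfolding edges_snark[OF assms(1)] by (elim UnE CollectE exE conjE insertE emptyE) simp_all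
  then show ?thesis by (simp add: Inr T_def)
qed

lemma elem_dist_elem_of:
  assumes "xs \<noteq> []" "set xs \<subseteq> verts (flower_snark n)" "w \<in> verts (flower_snark n)"
  shows "elem_dist (flower_snark n) (elem_of xs) w = list_dist n xs w"
proof -
  have "list_dist n xs w = Min ((\<lambda>v. gdist (flower_snark n) v w) ` set xs)"
    using assms
  proof (induction n xs w rule: list_dist.induct)
    case (3 n v u us w)
    then show ?case by (simp add: gdist_snark)
  qed (auto simp: gdist_snark)
  then show ?thesis by (cases xs rule: list.exhaust) (auto simp: elem_of_def length_Suc_conv)
qed

lemma mixed_resolving_setI:
  assumes "n > 0" "set ws \<subseteq> verts (flower_snark n)"
    and inj: "inj_on (\<lambda>xs. map (list_dist n xs) ws) (\<Union>i<n. set (snark_star n i))"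
  shows "mixed_resolving_set (flower_snark n) (set ws)"
  unfolding mixed_resolving_set_def
proof (intro conjI ballI impI)
  show "set ws \<subseteq> verts (flower_snark n)" by fact
  fix x y assume "x \<in> elements (flower_snark n)" "y \<in> elements (flower_snark n)" "x \<noteq> y"
  then obtain i j xs ys where *: "i < n" "xs \<in> set (snark_star n i)" "elem_of xs = x"
      "j < n" "ys \<in> set (snark_star n j)" "elem_of ys = y"
    using ex_elem_of_star[OF assms(1)] by meson
  then have "map (list_dist n xs) ws \<noteq> map (list_dist n ys) ws"
    using inj_onD[OF inj, of xs ys] \<open>x \<noteq> y\<close> by auto
  then obtain w where w: "w \<in> set ws" "list_dist n xs w \<noteq> list_dist n ys w" by auto
  then have "w \<in> verts (flower_snark n)" using assms(2) by blast
  then have "elem_dist (flower_snark n) x w = list_dist n xs w"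
    "elem_dist (flower_snark n) y w = list_dist n ys w"
    using elem_dist_elem_of[of _ n w] elem_of_star * by auto
  then show "\<exists>w\<in>set ws. elem_dist (flower_snark n) x w \<noteq> elem_dist (flower_snark n) y w"
    using w by (intro bexI[of _ w]) simp_all
qed

lemma mixed_metric_dimension_eqI:
  assumes "mixed_resolving_set G S" "finite S" "card S = k"
    and "\<And>T. mixed_resolving_set G T \<Longrightarrow> finite T \<Longrightarrow> k \<le> card T"
  shows "mixed_metric_dimension G = k"
  unfolding mixed_metric_dimension_def using assms by (intro Least_equality) auto

section \<open>The case of five petals\<close>

fun transversal :: "nat \<Rightarrow> 'a list list \<Rightarrow> bool" where
  "transversal k [] \<longleftrightarrow> True"
| "transversal 0 (M # Ms) \<longleftrightarrow> False"
| "transversal (Suc k) (M # Ms) \<longleftrightarrow>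
    list_ex (\<lambda>v. transversal k (filter (\<lambda>N. v \<notin> set N) Ms)) M"

lemma transversal_if_hitting:
  assumes "finite S" "card S \<le> k" "\<And>M. M \<in> set Ms \<Longrightarrow> set M \<inter> S \<noteq> {}"
  shows "transversal k Ms"
  using assms
proof (induction k Ms arbitrary: S rule: transversal.induct)
  case (3 k M Ms)
  from "3.prems"(3)[of M] obtain v where v: "v \<in> set M" "v \<in> S" by auto
  have "transversal k (filter (\<lambda>N. v \<notin> set N) Ms)"
  proof (rule "3.IH"[OF v(1)])
    show "card (S - {v}) \<le> k" using "3.prems"(1,2) v by simp
    show "set N \<inter> (S - {v}) \<noteq> {}" if "N \<in> set (filter (\<lambda>N. v \<notin> set N) Ms)" for N
      using that "3.prems"(3)[of N] by auto
  qed (use "3.prems"(1) in simp)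
  then show ?case using v by (auto simp: list_ex_iff)
qed auto

definition snark_vertices :: "nat \<Rightarrow> snark_vertex list" where
  "snark_vertices n = concat (map (\<lambda>i. [A i, B i, C i, D i]) [0..<n])"

definition separators :: "nat \<Rightarrow> snark_vertex list \<times> snark_vertex list \<Rightarrow> snark_vertex list" where
  "separators n xy = filter (\<lambda>w. list_dist n (fst xy) w \<noteq> list_dist n (snd xy) w) (snark_vertices n)"

definition snark_items :: "nat \<Rightarrow> snark_vertex list list" where
  "snark_items n = concat (map (snark_star n) [0..<n])"

lemma set_snark_items: "set (snark_items n) = (\<Union>i<n. set (snark_star n i))"
  by (auto simp: snark_items_def)

text \<open>
  Unions of orbits under the rotation of order 10, found by computer; \<open>e p\<close> runs through the cycle of
  \<open>c\<close>- and \<open>d\<close>-vertices. Edges are oriented as in \<open>snark_star\<close>. Pairs with few separating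
  landmarks come first, which keeps the search tree small.
\<close>

definition test_pairs :: "(snark_vertex list \<times> snark_vertex list) list" where
  "test_pairs = (let a = (\<lambda>p. A (p mod 5)); b = (\<lambda>p. B (p mod 5));
      e = (\<lambda>p. if p mod 10 < 5 then C (p mod 10) else D (p mod 10 - 5)) in
    map (\<lambda>p. ([e p], [e p, e (p + 1)])) [0..<10] @
    map (\<lambda>p. ([e (p + 1)], [e p, e (p + 1)])) [0..<10] @
    map (\<lambda>p. ([e p, e (p + 1)], [e (p + 5), e (p + 6)])) [0..<5] @
    map (\<lambda>p. ([a p], [a p, e p])) [0..<10] @
    map (\<lambda>p. ([a p], [a p, b p])) [0..<5] @
    map (\<lambda>p. ([e p], [a p, e p])) [0..<10] @
    map (\<lambda>p. ([e p], [b (p + 2), b (p + 3)])) [0..<10] @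
    map (\<lambda>p. ([b p], [e (p + 2), e (p + 3)])) [0..<10] @
    map (\<lambda>p. ([a p, e p], [a (p + 2), e (p + 2)])) [0..<10])"

lemma test_pairs_no_transversal: "\<not> transversal 4 (map (separators 5) test_pairs)"
  by code_simp

lemma test_pairs_items:
  "list_all (\<lambda>(xs, ys). xs \<in> set (snark_items 5) \<and> ys \<in> set (snark_items 5) \<and> set xs \<noteq> set ys) test_pairs"
  by code_simp

lemma snark_5_lower_bound:
  assumes S: "mixed_resolving_set (flower_snark 5) S" "finite S"
  shows "5 \<le> card S"
proof (rule ccontr)
  assume "\<not> 5 \<le> card S"
  then have "card S \<le> 4" by simp
  have "set M \<inter> S \<noteq> {}" if M: "M \<in> set (map (separators 5) test_pairs)" for M
  proof -
    obtain xs ys where xy: "(xs, ys) \<in> set test_pairs" "M = separators 5 (xs, ys)" using M by auto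
    then have items: "xs \<in> set (snark_items 5)" "ys \<in> set (snark_items 5)" "set xs \<noteq> set ys"
      using test_pairs_items by (auto simp: list_all_iff)
    then obtain i j where ij: "i < 5" "xs \<in> set (snark_star 5 i)" "j < 5" "ys \<in> set (snark_star 5 j)"
      by (auto simp: set_snark_items)
    note x = elem_of_star[OF ij(1,2)] and y = elem_of_star[OF ij(3,4)]
    have "elem_of xs \<noteq> elem_of ys"
      using items(3) x y by (auto simp: elem_of_def length_Suc_conv split: if_splits)
    then obtain w where w: "w \<in> S" "w \<in> verts (flower_snark 5)"
        "elem_dist (flower_snark 5) (elem_of xs) w \<noteq> elem_dist (flower_snark 5) (elem_of ys) w"
      using S(1) x y unfolding mixed_resolving_set_def by blast
    then have "w \<in> set M"
      using x y by (cases w) (auto simp: elem_dist_elem_of xy(2) separators_def snark_vertices_def)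
    then show ?thesis using w(1) by blast
  qed
  then show False
    using transversal_if_hitting[OF S(2) \<open>card S \<le> 4\<close>] test_pairs_no_transversal by blast
qed

lemma inj_on_code_if_distinct:
  "distinct (map (\<lambda>xs. map (list_dist n xs) ws) (snark_items n)) \<Longrightarrow>
    inj_on (\<lambda>xs. map (list_dist n xs) ws) (\<Union>i<n. set (snark_star n i))"
  by (simp add: distinct_map set_snark_items)

lemma snark_5_resolving: "mixed_resolving_set (flower_snark 5) (set [A 0, B 0, C 0, D 1, A 3])"
proof (intro mixed_resolving_setI inj_on_code_if_distinct)
  show "distinct (map (\<lambda>xs. map (list_dist 5 xs) [A 0, B 0, C 0, D 1, A 3]) (snark_items 5))"
    by code_simp
qed simp_all

text \<open>This is the general landmark set at \<open>k = 3\<close>, checked by evaluation because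
  the table of codes below starts at \<open>k = 4\<close>.\<close>

lemma snark_7_resolving: "mixed_resolving_set (flower_snark 7) (set [B 0, C 1, D 3, C 5])"
proof (intro mixed_resolving_setI inj_on_code_if_distinct)
  show "distinct (map (\<lambda>xs. map (list_dist 7 xs) [B 0, C 1, D 3, C 5]) (snark_items 7))"
    by code_simp
qed simp_all

section \<open>Four landmarks for larger snarks\<close>

definition star_codes :: "nat \<Rightarrow> nat \<Rightarrow> nat list list" where
  "star_codes k i =
    map (\<lambda>xs. map (list_dist (2 * k + 1) xs) [B 0, C 1, D 3, C (k + 2)]) (snark_star (2 * k + 1) i)"

lemmas star_codes_unfold = star_codes_def snark_star_def cyc_def same_def cross_def gap_def

text \<open>
  The distances to the four landmarks are linear in \<open>i\<close> on \<open>3 \<le> i \<le> k\<close> and on \<open>k + 5 \<le> i\<close>; writing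
  \<open>k\<close> and \<open>i\<close> as sums avoids truncated subtraction in the table.
\<close>

lemma star_codes_cases:
  assumes "k \<ge> 4" "i < 2 * k + 1"
  obtains
  m where "k = m + 4" "i = 0" "star_codes k i =
      [[1, 2, 4, m + 4], [0, 3, 5, m + 5], [2, 1, 5, m + 5], [2, 3, 3, m + 3], [0, 2, 4, m + 4],
       [1, 1, 4, m + 4], [1, 2, 3, m + 3], [0, 2, 4, m + 5], [2, 0, 4, m + 5], [2, 2, 2, m + 3]]" |
  m where "k = m + 4" "i = 1" "star_codes k i =
      [[2, 1, 3, m + 5], [1, 2, 4, m + 6], [3, 0, 4, m + 5], [3, 2, 2, m + 4], [1, 1, 3, m + 5],
       [2, 0, 3, m + 5], [2, 1, 2, m + 4], [1, 2, 3, m + 6], [3, 0, 3, m + 4], [3, 2, 1, m + 4]]" |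
  m where "k = m + 4" "i = 2" "star_codes k i =
      [[3, 2, 2, m + 5], [2, 3, 3, m + 6], [4, 1, 3, m + 4], [4, 3, 1, m + 5], [2, 2, 2, m + 5],
       [3, 1, 2, m + 4], [3, 2, 1, m + 5], [2, 3, 2, m + 5], [4, 1, 2, m + 3], [4, 3, 0, m + 5]]" |
  x y where "k = x + y + 3" "i = x + 3" "star_codes k i =
      [[x + 4, x + 3, x + 1, y + 3], [x + 3, x + 4, x + 2, y + 4], [x + 5, x + 2, x + 2, y + 2],
       [x + 5, x + 4, x, y + 4], [x + 3, x + 3, x + 1, y + 3], [x + 4, x + 2, x + 1, y + 2],
       [x + 4, x + 3, x, y + 3], [x + 3, x + 4, x + 2, y + 3], [x + 5, x + 2, x + 2, y + 1],
       [x + 5, x + 4, x, y + 3]]" |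
  m where "k = m + 4" "i = m + 5" "star_codes k i =
      [[m + 5, m + 5, m + 3, 2], [m + 4, m + 6, m + 4, 3], [m + 6, m + 4, m + 4, 1],
       [m + 6, m + 5, m + 2, 3], [m + 4, m + 5, m + 3, 2], [m + 5, m + 4, m + 3, 1],
       [m + 5, m + 5, m + 2, 2], [m + 3, m + 6, m + 4, 2], [m + 5, m + 4, m + 4, 0],
       [m + 5, m + 4, m + 2, 2]]" |
  m where "k = m + 4" "i = m + 6" "star_codes k i =
      [[m + 4, m + 5, m + 4, 1], [m + 3, m + 6, m + 5, 2], [m + 5, m + 5, m + 5, 0],
       [m + 5, m + 4, m + 3, 2], [m + 3, m + 5, m + 4, 1], [m + 4, m + 5, m + 4, 0],
       [m + 4, m + 4, m + 3, 1], [m + 2, m + 5, m + 5, 2], [m + 4, m + 5, m + 5, 0],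
       [m + 4, m + 3, m + 3, 2]]" |
  m where "k = m + 4" "i = m + 7" "star_codes k i =
      [[m + 3, m + 4, m + 5, 2], [m + 2, m + 5, m + 6, 3], [m + 4, m + 5, m + 5, 1],
       [m + 4, m + 3, m + 4, 3], [m + 2, m + 4, m + 5, 2], [m + 3, m + 4, m + 5, 1],
       [m + 3, m + 3, m + 4, 2], [m + 1, m + 4, m + 6, 3], [m + 3, m + 4, m + 4, 1],
       [m + 3, m + 2, m + 4, 3]]" |
  m where "k = m + 4" "i = m + 8" "star_codes k i =
      [[m + 2, m + 3, m + 5, 3], [m + 1, m + 4, m + 6, 4], [m + 3, m + 4, m + 4, 2],
       [m + 3, m + 2, m + 5, 4], [m + 1, m + 3, m + 5, 3], [m + 2, m + 3, m + 4, 2],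
       [m + 2, m + 2, m + 5, 3], [m, m + 3, m + 5, 4], [m + 2, m + 3, m + 3, 2],
       [m + 2, m + 1, m + 5, 4]]" |
  x y where "k = x + y + 5" "i = 2 * x + y + 10" "star_codes k i =
      [[y + 2, y + 3, y + 5, x + 4], [y + 1, y + 4, y + 6, x + 5], [y + 3, y + 4, y + 4, x + 3],
       [y + 3, y + 2, y + 6, x + 5], [y + 1, y + 3, y + 5, x + 4], [y + 2, y + 3, y + 4, x + 3],
       [y + 2, y + 2, y + 5, x + 4], [y, y + 3, y + 5, x + 5], [y + 2, y + 3, y + 3, x + 3],
       [y + 2, y + 1, y + 5, x + 5]]"
proof -
  \<comment> \<open>The minima change branch only near the landmark indices 0, 1, 3,
    \<open>k + 2\<close> and the indices opposite to them.\<close>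
  consider "i = 0" | "i = 1" | "i = 2" | "3 \<le> i" "i \<le> k" | "i = k + 1" | "i = k + 2" | "i = k + 3" |
    "i = k + 4" | "k + 5 \<le> i"
    by linarith
  then show thesis
  proof cases
    case 1
    then show thesis using assms by (intro that(1)[of "k - 4"]) (auto simp: star_codes_unfold)
  next
    case 2
    then show thesis using assms by (intro that(2)[of "k - 4"]) (auto simp: star_codes_unfold)
  next
    case 3
    then show thesis using assms by (intro that(3)[of "k - 4"]) (auto simp: star_codes_unfold)
  next
    case 4
    then show thesis using assms by (intro that(4)[of "i - 3" "k - i"]) (auto simp: star_codes_unfold)
  next
    case 5
    then show thesis using assms by (intro that(5)[of "k - 4"]) (auto simp: star_codes_unfold)
  next
    case 6
    then show thesis using assms by (intro that(6)[of "k - 4"]) (auto simp: star_codes_unfold)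
  next
    case 7
    then show thesis using assms by (intro that(7)[of "k - 4"]) (auto simp: star_codes_unfold)
  next
    case 8
    then show thesis using assms by (intro that(8)[of "k - 4"]) (auto simp: star_codes_unfold)
  next
    case 9
    \<comment> \<open>\<open>y\<close> counts the steps left to the last index \<open>2 * k\<close>;
      the row also covers the closing edges, at \<open>y = 0\<close>.\<close>
    then show thesis using assms by (intro that(9)[of "i - k - 5" "2 * k - i"]) (auto simp: star_codes_unfold)
  qed
qed

text \<open>For every pair of rows, the two expressions for \<open>k\<close> together with
  \<open>i < j\<close> make any two codes differ in some coordinate by linear arithmetic.\<close>

lemma star_codes_disjoint:
  assumes "k \<ge> 4" "i < j" "j < 2 * k + 1"
  shows "set (star_codes k i) \<inter> set (star_codes k j) = {}"
proof -
  have i: "i < 2 * k + 1" using assms by simp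
  show ?thesis
    by (rule star_codes_cases[OF assms(1) i]; rule star_codes_cases[OF assms(1,3)];
        insert assms(2)) simp_all
qed

lemma distinct_star_codes:
  assumes "k \<ge> 4" "i < 2 * k + 1"
  shows "distinct (star_codes k i)"
  by (rule star_codes_cases[OF assms]) simp_all

lemma snark_resolving:
  assumes "k \<ge> 4"
  shows "mixed_resolving_set (flower_snark (2 * k + 1)) (set [B 0, C 1, D 3, C (k + 2)])"
proof (rule mixed_resolving_setI)
  define code where "code xs = map (list_dist (2 * k + 1) xs) [B 0, C 1, D 3, C (k + 2)]" for xs
  have star: "star_codes k i = map code (snark_star (2 * k + 1) i)" for i
    by (simp add: star_codes_def code_def)
  have "xs = ys"
    if "i < 2 * k + 1" "xs \<in> set (snark_star (2 * k + 1) i)"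
      "j < 2 * k + 1" "ys \<in> set (snark_star (2 * k + 1) j)" "code xs = code ys" for i j xs ys
  proof -
    have "code xs \<in> set (star_codes k i) \<inter> set (star_codes k j)"
      using that(2,4,5) by (metis IntI imageI list.set_map star)
    then have "i = j"
      using star_codes_disjoint[OF assms, of i j] star_codes_disjoint[OF assms, of j i] that
      by (cases i j rule: linorder_cases) auto
    then show ?thesis
      using distinct_star_codes[OF assms that(1)] that by (auto simp: star distinct_map dest: inj_onD)
  qed
  then show "inj_on (\<lambda>xs. map (list_dist (2 * k + 1) xs) [B 0, C 1, D 3, C (k + 2)])
      (\<Union>i<2 * k + 1. set (snark_star (2 * k + 1) i))"
    unfolding code_def[symmetric] by (intro inj_onI) blast
qed (use assms in simp_all)

section \<open>Lower bound four and conclusion\<close>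

lemma snark_lower_bound:
  assumes "odd n" "n \<ge> 5" "mixed_resolving_set (flower_snark n) S" "finite S"
  shows "4 \<le> card S"
proof (rule ccontr)
  assume "\<not> 4 \<le> card S"
  have "Inl (A 0) \<in> elements (flower_snark n)" "Inl (B 0) \<in> elements (flower_snark n)"
    using assms(2) by (auto simp: elements_def)
  then have "S \<noteq> {}"
    using assms(3) unfolding mixed_resolving_set_def by blast
  then have "card S \<noteq> 0" using assms(4) by simp
  then consider "card S = 1" | "card S = 2" | "card S = 3"
    using \<open>\<not> 4 \<le> card S\<close> by linarith
  \<comment> \<open>Smaller sets are written as triples with repetitions, which
    \<open>no_resolving_triple\<close> allows.\<close>
  then have "\<exists>s t u. S = {s, t, u}"
    by cases (metis card_1_singletonE insert_absorb2, metis card_2_iff insert_absorb2, metis card_3_iff)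
  then obtain s t u where "S = {s, t, u}" by blast
  then show False
    using no_resolving_triple[of n s t u] assms(1-3) by (auto simp: mixed_resolving_set_def)
qed

theorem theorem2p1:
  shows "mixed_metric_dimension (flower_snark 5) = 5 \<and>
         (\<forall>n. odd n \<and> n \<ge> 7 \<longrightarrow> mixed_metric_dimension (flower_snark n) = 4)"
proof (intro conjI allI impI)
  show "mixed_metric_dimension (flower_snark 5) = 5"
    using snark_5_resolving by (rule mixed_metric_dimension_eqI) (simp_all add: snark_5_lower_bound)
next
  fix n :: nat assume n: "odd n \<and> n \<ge> 7"
  then obtain k where k: "n = 2 * k + 1" by (blast elim: oddE)
  have "mixed_resolving_set (flower_snark n) (set [B 0, C 1, D 3, C (k + 2)])"
  proof (cases "k = 3")
    case True
    then show ?thesis using snark_7_resolving k by simp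
  next
    case False
    then show ?thesis using snark_resolving[of k] n k by simp
  qed
  then show "mixed_metric_dimension (flower_snark n) = 4"
    by (rule mixed_metric_dimension_eqI) (use n in \<open>auto intro: snark_lower_bound\<close>)
qed

end
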